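(* Let $v_i$ be a vertex of a closed space polygon without self-intersections with vertices $v_1,\dots,v_V\in\mathbb{R}^3$, with finite $\mathrm{MinRad}^{\pm}(v_i)$, and let $\theta$ be the turning angle at $v_i$. Let $n$ denote the oriented unit normal vector to the plane defined by $v_{i-1},v_i,v_{i+1}$, that is, the unit vector in the direction $(v_i-v_{i-1})\times(v_{i+1}-v_i)$. Define the scalar $$K=\frac{\|v_{i+1}-v_i\|}{2\cos\theta-2}$$ and the vectors $$V=\frac{v_{i+1}-v_i}{2\tan(\theta/2)\,\|v_{i+1}-v_i\|},\qquad W=K\,\frac{(v_{i-1}-v_i)\times n}{\|v_{i-1}-v_i\|^2},\qquad X=K\,\frac{n\times(v_{i+1}-v_i)}{\|v_{i+1}-v_i\|^2}.$$ Then the gradient of $\mathrm{MinRad}^+(v_i)$ with respect to the vertex positions, written as a triple of vectors located at $v_{i-1}$, $v_i$, $v_{i+1}$, is $$\nabla\,\mathrm{MinRad}^+(v_i)=\{\,W,\ -W-X-V,\ X+V\,\}.$$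
   Context: The turning angle $\theta$ at $v_i$ is the (exterior) angle between the directions $v_i-v_{i-1}$ and $v_{i+1}-v_i$. $\mathrm{MinRad}^-(v_i)=\frac{\|v_i-v_{i-1}\|}{2\tan(\theta/2)}$ and $\mathrm{MinRad}^+(v_i)=\frac{\|v_{i+1}-v_i\|}{2\tan(\theta/2)}$; finiteness of these means $\theta\neq 0$. $\mathrm{MinRad}^+(v_i)$ is regarded as a function of the positions of the vertices; it depends only on $v_{i-1},v_i,v_{i+1}$, and the triple lists the partial gradients in $\mathbb{R}^3$ with respect to $v_{i-1}$, $v_i$, $v_{i+1}$ in that order. *)

theory Defs
  imports "HOL-Analysis.Analysis"
begin

text \<open>A closed polygon with \<open>N\<close> vertices in space is given by the values of
  \<open>v :: nat \<Rightarrow> real^3\<close> on \<open>{1..N}\<close>, the indices being read cyclically.\<close>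

definition next_idx :: "nat \<Rightarrow> nat \<Rightarrow> nat" where
  "next_idx N i = (if i = N then 1 else i + 1)"

definition prev_idx :: "nat \<Rightarrow> nat \<Rightarrow> nat" where
  "prev_idx N i = (if i = 1 then N else i - 1)"

text \<open>The point at parameter \<open>t\<close> on the edge from vertex \<open>j\<close> to vertex \<open>j + 1\<close>.\<close>

definition edge_point :: "nat \<Rightarrow> (nat \<Rightarrow> real^3) \<Rightarrow> nat \<times> real \<Rightarrow> real^3" where
  "edge_point N v = (\<lambda>(j, t). (1 - t) *\<^sub>R v j + t *\<^sub>R v (next_idx N j))"

text \<open>The polygon is traversed exactly once as \<open>j\<close> ranges over \<open>{1..N}\<close> and \<open>t\<close> over
  the half-open interval \<open>{0..<1}\<close>, so injectivity there says that the closed curve does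
  not meet itself. It excludes degenerate edges and overlapping consecutive edges.\<close>

definition embedded_closed_polygon :: "nat \<Rightarrow> (nat \<Rightarrow> real^3) \<Rightarrow> bool" where
  "embedded_closed_polygon N v \<longleftrightarrow>
     3 \<le> N \<and> inj_on (edge_point N v) ({1..N} \<times> {0..<1})"

definition vec_angle :: "real^3 \<Rightarrow> real^3 \<Rightarrow> real" where
  "vec_angle x y = arccos (x \<bullet> y / (norm x * norm y))"

definition turning_angle :: "nat \<Rightarrow> (nat \<Rightarrow> real^3) \<Rightarrow> nat \<Rightarrow> real" where
  "turning_angle N v i = vec_angle (v i - v (prev_idx N i)) (v (next_idx N i) - v i)"

text \<open>Both radii are infinite where the turning angle vanishes. At turning angle \<open>pi\<close> the
  convention \<open>tan (pi / 2) = 0\<close> gives the limit value \<open>0\<close>; embedded polygons have no such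
  vertices.\<close>

definition MinRad_minus :: "nat \<Rightarrow> (nat \<Rightarrow> real^3) \<Rightarrow> nat \<Rightarrow> ereal" where
  "MinRad_minus N v i =
     (if turning_angle N v i = 0 then \<infinity>
      else ereal (norm (v i - v (prev_idx N i)) / (2 * tan (turning_angle N v i / 2))))"

definition MinRad_plus :: "nat \<Rightarrow> (nat \<Rightarrow> real^3) \<Rightarrow> nat \<Rightarrow> ereal" where
  "MinRad_plus N v i =
     (if turning_angle N v i = 0 then \<infinity>
      else ereal (norm (v (next_idx N i) - v i) / (2 * tan (turning_angle N v i / 2))))"

text \<open>\<open>MinRad\<^sup>+(v\<^sub>i)\<close> as a function of the positions of the vertices
  \<open>i - 1\<close>, \<open>i\<close>, \<open>i + 1\<close>; it does not depend on the other vertices. Its gradient in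
  \<open>(real^3) \<times> (real^3) \<times> (real^3)\<close> is the triple of the partial gradients.\<close>

definition MinRad_plus_at ::
    "nat \<Rightarrow> (nat \<Rightarrow> real^3) \<Rightarrow> nat \<Rightarrow> (real^3) \<times> (real^3) \<times> (real^3) \<Rightarrow> real" where
  "MinRad_plus_at N v i = (\<lambda>(a, b, c).
     real_of_ereal
       (MinRad_plus N (v(prev_idx N i := a, i := b, next_idx N i := c)) i))"

end

theory Submission
  imports Defs
begin

text \<open>
  Write \<open>p = v\<^sub>i - v\<^sub>i\<^sub>-\<^sub>1\<close> and \<open>q = v\<^sub>i\<^sub>+\<^sub>1 - v\<^sub>i\<close> for the two edges at the vertex, so that
  the radius is \<open>\<bar>q\<bar> cot (\<theta> / 2) / 2\<close> with \<open>\<theta>\<close> the angle from \<open>p\<close> to \<open>q\<close>. To first order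
  \<open>\<theta>\<close> changes only when \<open>p\<close> or \<open>q\<close> is rotated in the plane that they span. Turning \<open>q\<close> about
  \<open>n\<close> opens the angle and turning \<open>p\<close> about \<open>n\<close> closes it, by the displacement of the tip
  divided by the length of the vector. Hence the partial gradients of \<open>\<theta>\<close> are \<open>p \<times> n / \<bar>p\<bar>\<^sup>2\<close> in \<open>p\<close> and
  \<open>n \<times> q / \<bar>q\<bar>\<^sup>2\<close> in \<open>q\<close> (\<open>GDERIV_vec_angle\<close>).

  The derivative of \<open>cot (\<theta> / 2) / 2\<close> is \<open>- 1 / (4 sin\<^sup>2 (\<theta> / 2)) = 1 / (2 cos \<theta> - 2)\<close>. In the
  product rule, \<open>K\<close>, which is \<open>\<bar>q\<bar>\<close> times this, is therefore the factor of the gradient of \<open>\<theta>\<close>, which gives \<open>W\<close> and \<open>X\<close>,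
  and \<open>V\<close> is the contribution of the gradient of \<open>\<bar>q\<bar>\<close> (\<open>GDERIV_norm_half_cot\<close>). The edges are
  differences of vertices, so passing back to the vertices is a linear change of variables. It
  makes the three partial gradients add up to zero, as translation invariance demands
  (\<open>GDERIV_edge_vectors\<close>).

  All of this requires \<open>p\<close> and \<open>q\<close> to be linearly independent. Finiteness of the radius excludes
  parallel edges of the same direction, and embeddedness excludes the rest: an edge of length
  zero or a reversal of direction makes the polygon meet itself (\<open>cross_nonzero_at_vertex\<close>).
\<close>

section \<open>The gradient of the angle between two vectors\<close>

lemma abs_inner_less_norm_mult:
  fixes p q :: "real^3"
  assumes "cross3 p q \<noteq> 0"
  shows "\<bar>p \<bullet> q\<bar> < norm p * norm q"
proof -
  have "\<bar>p \<bullet> q\<bar> \<noteq> norm p * norm q"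
    using assms by (simp add: norm_cauchy_schwarz_equal cross_eq_0)
  then show ?thesis
    using Cauchy_Schwarz_ineq2[of p q] by linarith
qed

lemma vec_angle_strictly_between:
  assumes "cross3 p q \<noteq> 0"
  shows "0 < vec_angle p q" "vec_angle p q < pi"
proof -
  have "p \<noteq> 0" "q \<noteq> 0" using assms by auto
  then have "\<bar>(p \<bullet> q) / (norm p * norm q)\<bar> < 1"
    using abs_inner_less_norm_mult[OF assms] by (simp add: abs_mult)
  then show "0 < vec_angle p q" "vec_angle p q < pi"
    unfolding vec_angle_def using arccos_lt_bounded[of "(p \<bullet> q) / (norm p * norm q)"]
    by (simp_all only: abs_less_iff minus_less_iff[of _ 1])
qed

text \<open>This is \<open>sin \<theta> = \<bar>p \<times> q\<bar> / (\<bar>p\<bar> \<bar>q\<bar>)\<close>, in the form in which the derivative of the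
  arc cosine produces the sine.\<close>

lemma sqrt_one_minus_cosine_squared:
  fixes p q :: "real^3"
  assumes "p \<noteq> 0" "q \<noteq> 0"
  shows "sqrt (1 - ((p \<bullet> q) / (norm p * norm q))\<^sup>2) = norm (cross3 p q) / (norm p * norm q)"
proof (rule real_sqrt_unique)
  have "(norm p * norm q)\<^sup>2 \<noteq> 0" using assms by simp
  then show "(norm (cross3 p q) / (norm p * norm q))\<^sup>2 = 1 - ((p \<bullet> q) / (norm p * norm q))\<^sup>2"
    using norm_cross_dot[of p q] by (simp add: power_divide divide_simps)
qed simp

text \<open>By the triple product expansion, up to scale these are the vectors in the plane of \<open>p\<close> and \<open>q\<close>
  orthogonal to \<open>p\<close> and to \<open>q\<close>. Only inner products are left on the right-hand sides, and
  these are what differentiating the cosine of the angle yields.\<close>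

lemma cross_sgn_cross:
  fixes p q :: "real^3"
  shows "cross3 p (sgn (cross3 p q)) = ((p \<bullet> q) *\<^sub>R p - (norm p)\<^sup>2 *\<^sub>R q) /\<^sub>R norm (cross3 p q)"
    and "cross3 (sgn (cross3 p q)) q = ((p \<bullet> q) *\<^sub>R q - (norm q)\<^sup>2 *\<^sub>R p) /\<^sub>R norm (cross3 p q)"
proof -
  have "cross3 p (cross3 p q) = (p \<bullet> q) *\<^sub>R p - (p \<bullet> p) *\<^sub>R q"
    by (simp add: cross3_simps forall_3)
  then show "cross3 p (sgn (cross3 p q)) = ((p \<bullet> q) *\<^sub>R p - (norm p)\<^sup>2 *\<^sub>R q) /\<^sub>R norm (cross3 p q)"
    by (simp add: sgn_div_norm cross_mult_right power2_norm_eq_inner)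
  have "cross3 (cross3 p q) q = (p \<bullet> q) *\<^sub>R q - (q \<bullet> q) *\<^sub>R p"
    by (simp add: cross3_simps forall_3)
  then show "cross3 (sgn (cross3 p q)) q = ((p \<bullet> q) *\<^sub>R q - (norm q)\<^sup>2 *\<^sub>R p) /\<^sub>R norm (cross3 p q)"
    by (simp add: sgn_div_norm cross_mult_left power2_norm_eq_inner)
qed

text \<open>An infinitesimal change of \<open>p\<close> along itself or out of the plane does not change the angle,
  so the gradient in \<open>p\<close> is a multiple of \<open>p \<times> n\<close>; turning \<open>p\<close> by a small angle moves its tip by
  \<open>\<bar>p\<bar>\<close> times that angle, which fixes the length \<open>1 / \<bar>p\<bar>\<close>. The same holds for \<open>q\<close>, with the
  opposite orientation. The proof differentiates the formula for the arc cosine and compares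
  inner products.\<close>

lemma GDERIV_vec_angle:
  fixes p q :: "real^3"
  assumes "cross3 p q \<noteq> 0"
  shows "GDERIV (\<lambda>(x, y). vec_angle x y) (p, q) :>
    ((1 / norm p)\<^sup>2 *\<^sub>R cross3 p (sgn (cross3 p q)),
     (1 / norm q)\<^sup>2 *\<^sub>R cross3 (sgn (cross3 p q)) q)"
proof -
  define P Q S D where "P = norm p" "Q = norm q" "S = norm (cross3 p q)" "D = p \<bullet> q"
  have nz: "p \<noteq> 0" "q \<noteq> 0" using assms by auto
  have pos: "P > 0" "Q > 0" "S > 0"
    using nz assms by (auto simp: P_Q_S_D_def)
  have bound: "-1 < D / (P * Q)" "D / (P * Q) < 1"
    using abs_inner_less_norm_mult[OF assms] pos by (auto simp: P_Q_S_D_def field_simps)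
  have norm_fst: "((\<lambda>z. norm (fst z)) has_derivative (\<lambda>h. fst h \<bullet> sgn p)) (at (p, q))"
    using has_derivative_compose[OF has_derivative_fst[OF has_derivative_ident], of norm _ "(p, q)"]
      has_derivative_norm[OF nz(1)] by simp
  have norm_snd: "((\<lambda>z. norm (snd z)) has_derivative (\<lambda>h. snd h \<bullet> sgn q)) (at (p, q))"
    using has_derivative_compose[OF has_derivative_snd[OF has_derivative_ident], of norm _ "(p, q)"]
      has_derivative_norm[OF nz(2)] by simp
  have inner: "((\<lambda>z. fst z \<bullet> snd z) has_derivative (\<lambda>h. p \<bullet> snd h + fst h \<bullet> q)) (at (p, q))"
    by (auto intro!: derivative_eq_intros)
  have norms: "((\<lambda>z. norm (fst z) * norm (snd z)) has_derivative
      (\<lambda>h. P * (snd h \<bullet> sgn q) + (fst h \<bullet> sgn p) * Q)) (at (p, q))"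
    using has_derivative_mult[OF norm_fst norm_snd] by (simp add: P_Q_S_D_def)
  have cosine: "((\<lambda>z. (fst z \<bullet> snd z) / (norm (fst z) * norm (snd z))) has_derivative
      (\<lambda>h. ((p \<bullet> snd h + fst h \<bullet> q) * (P * Q)
        - D * (P * (snd h \<bullet> sgn q) + (fst h \<bullet> sgn p) * Q)) / (P * Q * (P * Q)))) (at (p, q))"
    using has_derivative_divide'[OF inner norms] nz by (simp add: P_Q_S_D_def)
  have "DERIV arccos (D / (P * Q)) :> - (P * Q / S)"
    using DERIV_arccos[OF bound] sqrt_one_minus_cosine_squared[OF nz]
    by (simp add: P_Q_S_D_def)
  then have angle: "((\<lambda>z. arccos ((fst z \<bullet> snd z) / (norm (fst z) * norm (snd z)))) has_derivative
      (\<lambda>h. ((p \<bullet> snd h + fst h \<bullet> q) * (P * Q)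
        - D * (P * (snd h \<bullet> sgn q) + (fst h \<bullet> sgn p) * Q)) / (P * Q * (P * Q)) * - (P * Q / S)))
      (at (p, q))"
    by (intro DERIV_compose_FDERIV[OF _ cosine]) (simp add: P_Q_S_D_def)
  have gradient: "((p \<bullet> snd h + fst h \<bullet> q) * (P * Q) - D * (P * (snd h \<bullet> sgn q) + (fst h \<bullet> sgn p) * Q))
        / (P * Q * (P * Q)) * - (P * Q / S)
      = h \<bullet> ((1 / P)\<^sup>2 *\<^sub>R cross3 p (sgn (cross3 p q)),
                (1 / Q)\<^sup>2 *\<^sub>R cross3 (sgn (cross3 p q)) q)" for h
  proof -
    have sgn: "snd h \<bullet> sgn q = (snd h \<bullet> q) / Q" "fst h \<bullet> sgn p = (fst h \<bullet> p) / P"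
      by (simp_all add: sgn_div_norm P_Q_S_D_def divide_inverse mult.commute)
    have "h \<bullet> ((1 / P)\<^sup>2 *\<^sub>R cross3 p (sgn (cross3 p q)),
                (1 / Q)\<^sup>2 *\<^sub>R cross3 (sgn (cross3 p q)) q)
        = (1 / P)\<^sup>2 * (D * (fst h \<bullet> p) - P\<^sup>2 * (fst h \<bullet> q)) / S + (1 / Q)\<^sup>2 * (D * (snd h \<bullet> q) - Q\<^sup>2 * (snd h \<bullet> p)) / S"
      by (simp add: inner_prod_def cross_sgn_cross inner_diff_right divide_inverse mult_ac flip: P_Q_S_D_def)
    also have "\<dots> = ((snd h \<bullet> p + fst h \<bullet> q) * (P * Q) - D * (P * ((snd h \<bullet> q) / Q) + ((fst h \<bullet> p) / P) * Q))
        / (P * Q * (P * Q)) * - (P * Q / S)"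
      using pos by (simp add: divide_simps power2_eq_square) (simp add: algebra_simps)
    finally show ?thesis
      unfolding sgn inner_commute[of p "snd h"] by (rule sym)
  qed
  show ?thesis
    using angle[unfolded gradient]
    by (simp only: gderiv_def vec_angle_def case_prod_beta' P_Q_S_D_def)
qed

section \<open>The gradient in terms of the two edges\<close>

text \<open>The product rule for \<open>\<bar>q\<bar> \<cdot> (cot (\<theta> / 2) / 2)\<close>. The half-angle formula
  \<open>1 - cos \<theta> = 2 sin\<^sup>2 (\<theta> / 2)\<close> turns \<open>\<bar>q\<bar>\<close> times the derivative of
  the second factor into \<open>K\<close>.\<close>


lemma GDERIV_norm_half_cot:
  fixes p q :: "real^3"
  assumes "cross3 p q \<noteq> 0"
  defines "\<theta> \<equiv> vec_angle p q" and "n \<equiv> sgn (cross3 p q)"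
  defines "K \<equiv> norm q / (2 * cos \<theta> - 2)"
  shows "GDERIV (\<lambda>(x, y). norm y / (2 * tan (vec_angle x y / 2))) (p, q) :>
    (K *\<^sub>R ((1 / norm p)\<^sup>2 *\<^sub>R cross3 p n),
     K *\<^sub>R ((1 / norm q)\<^sup>2 *\<^sub>R cross3 n q) + (1 / (2 * tan (\<theta> / 2) * norm q)) *\<^sub>R q)"
proof -
  have "0 < \<theta>" "\<theta> < pi"
    using vec_angle_strictly_between[OF assms(1)] by (auto simp: \<theta>_def)
  then have nz: "sin (\<theta>/2) > 0" "cos (\<theta>/2) > 0"
    by (auto intro!: sin_gt_zero cos_gt_zero)
  then have tan: "tan (\<theta>/2) \<noteq> 0" by (simp add: tan_def)
  have "cos \<theta> = 1 - 2 * (sin (\<theta>/2))\<^sup>2"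
    using cos_double_sin[of "\<theta>/2"] by simp
  then have K: "K = - (norm q / (4 * (sin (\<theta>/2))\<^sup>2))"
    using nz by (simp add: K_def divide_simps)
  have "DERIV (\<lambda>t. 1 / (2 * tan (t / 2))) \<theta> :> - (1 / (4 * (sin (\<theta>/2))\<^sup>2))"
    using nz tan
    by (auto intro!: derivative_eq_intros) (simp add: tan_def field_simps power2_eq_square)
  then have "DERIV (\<lambda>t. 1 / (2 * tan (t / 2))) ((\<lambda>(x, y). vec_angle x y) (p, q))
       :> - (1 / (4 * (sin (\<theta>/2))\<^sup>2))"
    by (simp add: \<theta>_def)
  note cot = GDERIV_DERIV_compose[OF GDERIV_vec_angle[OF assms(1)] this]
  have "q \<noteq> 0" using assms by auto
  have len: "GDERIV (\<lambda>(x, y). norm y) (p, q) :> (0, sgn q)"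
    using has_derivative_compose[OF has_derivative_snd[OF has_derivative_ident], of norm _ "(p, q)"]
      has_derivative_norm[OF \<open>q \<noteq> 0\<close>]
    by (simp add: gderiv_def case_prod_beta' inner_prod_def)
  have radial: "(1 / (2 * tan (\<theta>/2))) *\<^sub>R sgn q = (1 / (2 * tan (\<theta>/2) * norm q)) *\<^sub>R q"
    by (simp add: sgn_div_norm inverse_eq_divide)
  show ?thesis
    using GDERIV_mult[OF len cot] radial
    by (simp add: K \<theta>_def n_def case_prod_beta')
qed

section \<open>The edges at a vertex of an embedded polygon\<close>

text \<open>Otherwise one of the two edges has length zero, or \<open>q = s p\<close> with \<open>s \<noteq> 0\<close>. A positive \<open>s\<close>
  makes the turning angle zero. For negative \<open>s\<close> the second edge runs back along the first, so
  the far end of the shorter of the two lies on the other one and the curve meets itself there.\<close>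

lemma cross_nonzero_at_vertex:
  assumes polygon: "embedded_closed_polygon N v" and i: "i \<in> {1..N}"
    and turn: "turning_angle N v i \<noteq> 0"
  shows "cross3 (v i - v (prev_idx N i)) (v (next_idx N i) - v i) \<noteq> 0"
proof
  define a b c where "a = v (prev_idx N i)" "b = v i" "c = v (next_idx N i)"
  note abc = a_b_c_def
  have N: "3 \<le> N" and inj: "inj_on (edge_point N v) ({1..N} \<times> {0..<1})"
    using polygon by (auto simp: embedded_closed_polygon_def)
  have idx: "prev_idx N i \<in> {1..N}" "next_idx N i \<in> {1..N}"
    "prev_idx N i \<noteq> i" "next_idx N i \<noteq> i" "prev_idx N i \<noteq> next_idx N i" "next_idx N (prev_idx N i) = i"
    using i N by (auto simp: prev_idx_def next_idx_def)
  have sep: "edge_point N v (j, s) \<noteq> edge_point N v (k, t)"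
    if "j \<in> {1..N}" "k \<in> {1..N}" "0 \<le> s" "s < 1" "0 \<le> t" "t < 1" "j \<noteq> k" for j k s t
    using inj_onD[OF inj, of "(j, s)" "(k, t)"] that by auto
  have edge: "edge_point N v (prev_idx N i, t) = (1 - t) *\<^sub>R a + t *\<^sub>R b"
     "edge_point N v (i, t) = (1 - t) *\<^sub>R b + t *\<^sub>R c" "edge_point N v (next_idx N i, 0) = c" for t
    by (simp_all add: edge_point_def idx abc)
  have ab: "b - a \<noteq> 0" using sep[of "prev_idx N i" i 0 0] idx i edge(1,2)[of 0] by auto
  have bc: "c - b \<noteq> 0" using sep[of "next_idx N i" i 0 0] idx i edge(2)[of 0] edge(3) by auto
  assume "cross3 (v i - v (prev_idx N i)) (v (next_idx N i) - v i) = 0"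
  then have "collinear {0, b - a, c - b}" by (simp add: cross_eq_0 abc)
  then obtain s where s: "c - b = s *\<^sub>R (b - a)"
    using ab bc by (auto simp: collinear_lemma)
  have "s \<noteq> 0" using s bc by auto
  then consider "s > 0" | "s < 0" "-s \<le> 1" | "-s > 1" by linarith
  then show False
  proof cases
    case 1
    then have "turning_angle N v i = 0"
      using s ab bc
      by (simp add: turning_angle_def vec_angle_def flip: abc power2_norm_eq_inner)
         (simp add: power2_eq_square)
    then show False using turn by simp
  next
    case 2
    \<comment> \<open>The second edge is not longer than the first, so its end lies on the first edge.\<close>
    have "c = (1 - (1 + s)) *\<^sub>R a + (1 + s) *\<^sub>R b"
      using s by (simp add: algebra_simps)
    then show False
      using sep[of "prev_idx N i" "next_idx N i" "1 + s" 0] 2 idx edge by simp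
  next
    case 3
    \<comment> \<open>The first edge is shorter, so its start lies on the second edge.\<close>
    have "b - a = (1 / s) *\<^sub>R (c - b)" using s 3 by simp
    then have "a = (1 - (-1/s)) *\<^sub>R b + (-1/s) *\<^sub>R c"
      by (simp add: algebra_simps)
    then show False
      using sep[of "prev_idx N i" i 0 "-1/s"] 3 idx i edge(1)[of 0] edge(2)[of "-1/s"]
      by (simp add: divide_simps)
  qed
qed

section \<open>The gradient in terms of the three vertices\<close>

text \<open>At least three vertices are needed: then the three indices are distinct, and the updates
  of the vertex positions do not overwrite each other. The value \<open>0\<close> comes from the conversion
  of the infinite radius to a real number.\<close>

lemma MinRad_plus_at_eq:
  assumes "3 \<le> N" "i \<in> {1..N}"
  shows "MinRad_plus_at N v i (a, b, c) =
    (if vec_angle (b - a) (c - b) = 0 then 0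
     else norm (c - b) / (2 * tan (vec_angle (b - a) (c - b) / 2)))"
proof -
  have "prev_idx N i \<noteq> i" "next_idx N i \<noteq> i" "prev_idx N i \<noteq> next_idx N i"
    using assms by (auto simp: prev_idx_def next_idx_def)
  then show ?thesis
    by (simp add: MinRad_plus_at_def MinRad_plus_def turning_angle_def)
qed

text \<open>The adjoint of the linear map \<open>(a, b, c) \<mapsto> (b - a, c - b)\<close>, applied to \<open>(A, C)\<close>, is
  \<open>(- A, A - C, C)\<close>.\<close>

lemma GDERIV_edge_vectors:
  fixes a b c :: "real^3"
  assumes "GDERIV f (b - a, c - b) :> (A, C)"
  shows "GDERIV (\<lambda>(a, b, c). f (b - a, c - b)) (a, b, c) :> (- A, A - C, C)"
proof -
  have "((\<lambda>(a, b, c). (b - a, c - b)) has_derivative (\<lambda>(a, b, c). (b - a, c - b))) (at (a, b, c))"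
    unfolding case_prod_beta by (auto intro!: derivative_eq_intros)
  then have "((\<lambda>x. f (case x of (a, b, c) \<Rightarrow> (b - a, c - b))) has_derivative
      (\<lambda>h. (case h of (a, b, c) \<Rightarrow> (b - a, c - b)) \<bullet> (A, C))) (at (a, b, c))"
    by (rule has_derivative_compose) (use assms in \<open>simp add: gderiv_def\<close>)
  then show ?thesis
    unfolding gderiv_def case_prod_beta
    by (rule has_derivative_eq_rhs) (auto simp: fun_eq_iff inner_diff_left inner_diff_right)
qed

theorem proposition3p4:
  fixes v :: "nat \<Rightarrow> real^3" and N i :: nat
    and \<theta> K :: real and n V W X :: "real^3"
  assumes polygon: "embedded_closed_polygon N v"
    and i: "i \<in> {1..N}"
    and finite_minus: "\<bar>MinRad_minus N v i\<bar> \<noteq> \<infinity>"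
    and finite_plus: "\<bar>MinRad_plus N v i\<bar> \<noteq> \<infinity>"
    and \<theta>: "\<theta> = turning_angle N v i"
    and n: "n = sgn (cross3 (v i - v (prev_idx N i)) (v (next_idx N i) - v i))"
    and K: "K = norm (v (next_idx N i) - v i) / (2 * cos \<theta> - 2)"
    and V: "V = (1 / (2 * tan (\<theta> / 2) * norm (v (next_idx N i) - v i)))
                  *\<^sub>R (v (next_idx N i) - v i)"
    and W: "W = K *\<^sub>R ((1 / (norm (v (prev_idx N i) - v i))\<^sup>2)
                  *\<^sub>R cross3 (v (prev_idx N i) - v i) n)"
    and X: "X = K *\<^sub>R ((1 / (norm (v (next_idx N i) - v i))\<^sup>2)
                  *\<^sub>R cross3 n (v (next_idx N i) - v i))"
  shows "GDERIV (MinRad_plus_at N v i) (v (prev_idx N i), v i, v (next_idx N i))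
           :> (W, - W - X - V, X + V)"
proof -
  define a b c where "a = v (prev_idx N i)" "b = v i" "c = v (next_idx N i)"
  note abc = a_b_c_def
  have N: "3 \<le> N" using polygon by (simp add: embedded_closed_polygon_def)
  have \<theta>_eq: "\<theta> = vec_angle (b - a) (c - b)"
    by (simp add: \<theta> turning_angle_def abc)
  have "turning_angle N v i \<noteq> 0"
    using finite_plus by (auto simp: MinRad_plus_def)
  then have cross: "cross3 (b - a) (c - b) \<noteq> 0"
    using cross_nonzero_at_vertex[OF polygon i] by (simp add: abc)
  \<comment> \<open>\<open>W\<close> is expressed by the reversed edge \<open>a - b\<close>. This absorbs the sign that comes from
    differentiating \<open>b - a\<close> with respect to \<open>a\<close>.\<close>
  have swap: "cross3 (a - b) n = - cross3 (b - a) n"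
    by (metis cross_minus_left minus_diff_eq)
  have W': "W = - (K *\<^sub>R ((1 / norm (b - a))\<^sup>2 *\<^sub>R cross3 (b - a) n))"
    using swap by (simp add: W norm_minus_commute[of a b] power_divide flip: abc)
  have X': "X = K *\<^sub>R ((1 / norm (c - b))\<^sup>2 *\<^sub>R cross3 n (c - b))"
    by (simp add: X power_divide flip: abc)
  have "GDERIV (\<lambda>(a, b, c). norm (c - b) / (2 * tan (vec_angle (b - a) (c - b) / 2))) (a, b, c)
      :> (W, - W - X - V, X + V)"
    using GDERIV_edge_vectors[OF GDERIV_norm_half_cot[OF cross]]
    by (simp add: V W' X' K n \<theta>_eq algebra_simps flip: abc)
  then have deriv: "((\<lambda>(a, b, c). norm (c - b) / (2 * tan (vec_angle (b - a) (c - b) / 2)))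
      has_derivative (\<lambda>h. h \<bullet> (W, - W - X - V, X + V))) (at (a, b, c))"
    by (simp only: gderiv_def)
  \<comment> \<open>The radius agrees with the differentiated formula only where the angle is nonzero.
    The angle is continuous, so this holds in a neighbourhood.\<close>
  have "isCont (\<lambda>(a, b, c). vec_angle (b - a) (c - b)) (a, b, c)"
    using has_derivative_continuous[OF GDERIV_edge_vectors[OF GDERIV_vec_angle[OF cross], unfolded gderiv_def]]
    by simp
  then have "\<forall>\<^sub>F (a, b, c) in at (a, b, c). vec_angle (b - a) (c - b) \<noteq> 0"
    using vec_angle_strictly_between(1)[OF cross] tendsto_imp_eventually_ne[of _ _ _ 0]
    unfolding isCont_def case_prod_beta by fastforce
  then have "\<forall>\<^sub>F x in at (a, b, c). (case x of (a, b, c) \<Rightarrow>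
      norm (c - b) / (2 * tan (vec_angle (b - a) (c - b) / 2))) = MinRad_plus_at N v i x"
    by (rule eventually_mono) (auto simp: MinRad_plus_at_eq[OF N i])
  from has_derivative_transform_eventually[OF deriv this]
  show ?thesis
    using vec_angle_strictly_between(1)[OF cross]
    by (simp add: gderiv_def MinRad_plus_at_eq[OF N i] flip: abc)
qed

end
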